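(* Let $m\geqslant 3$ be an odd integer. Then the number of distinct $C_4$-face-magic projective labelings on $\mathcal{P}_{m,m}$ with $C_4$-face-magic value $2m^2+1$, counted up to symmetries of the projective plane, is at least $\tau(m,m)\,2^{m-3}\,\bigl(\beta(m)\bigr)^2$; the same lower bound holds for those with $C_4$-face-magic value $2m^2+3$.
   Context: $\mathcal{P}_{m,n}$ has vertices $(i,j)$, $1\leqslant i\leqslant m$, $1\leqslant j\leqslant n$, and edges $(i,j)$–$(i,j+1)$ ($j\leqslant n-1$), $(i,n)$–$(m+1-i,1)$, $(i,j)$–$(i+1,j)$ ($i\leqslant m-1$), $(m,j)$–$(1,n+1-j)$, embedded naturally in the projective plane. Its 4-cycle faces are $\{(i,j),(i+1,j),(i,j+1),(i+1,j+1)\}$ ($1\leqslant i\leqslant m-1$, $1\leqslant j\leqslant n-1$), $\{(i,n),(i+1,n),(m+1-i,1),(m-i,1)\}$ ($1\leqslant i\leqslant m-1$), $\{(m,j),(m,j+1),(1,n+1-j),(1,n-j)\}$ ($1\leqslant j\leqslant n-1$); the other two faces are digons. A $C_4$-face-magic projective labeling is a bijection from the vertices onto $\{1,\ldots,mn\}$ such that every 4-cycle face has the same label sum, the $C_4$-face-magic value. For $\mathcal{P}_{m,m}$ the symmetries are the 8 elements of the dihedral group generated by the rotation $(i,j)\mapsto(m+1-j,i)$ and the reflection $(i,j)\mapsto(i,m+1-j)$ about the center vertex; labelings are counted up to precomposition with these. For positive integer $k$, an $(m,n)$-projective factorization sequence is a tuple $(m_1,n_1,\ldots,m_k,n_k)$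 of integers $>1$ with $m=m_1\cdots m_k$, $n=n_1\cdots n_k$, or a tuple $(m_1,n_1,\ldots,m_k,n_k,m_{k+1})$ of integers $>1$ with $m=m_1\cdots m_{k+1}$, $n=n_1\cdots n_k$; $\tau(m,n)$ is the number of distinct such sequences. For odd $m\geqslant3$, $\beta(m)=\bigl((\tfrac{m-1}{4})!\bigr)^2$ if $m\equiv1\pmod4$ and $\beta(m)=(\tfrac{m-3}{4})!\,(\tfrac{m+1}{4})!$ if $m\equiv3\pmod4$. *)

theory Defs
  imports Main "HOL-Algebra.Bij" "HOL-Algebra.Generated_Groups"
begin

definition pverts :: "nat \<Rightarrow> nat \<Rightarrow> (nat \<times> nat) set" where
  "pverts m n = {1..m} \<times> {1..n}"

text \<open>The 4-cycle faces of the projective grid graph, each given by its set of vertices;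
  for \<open>m, n > 1\<close> each such set has exactly four elements.\<close>

definition c4_faces :: "nat \<Rightarrow> nat \<Rightarrow> (nat \<times> nat) set set" where
  "c4_faces m n =
     {{(i, j), (i + 1, j), (i, j + 1), (i + 1, j + 1)} | i j. i \<in> {1..m - 1} \<and> j \<in> {1..n - 1}}
   \<union> {{(i, n), (i + 1, n), (m + 1 - i, 1), (m - i, 1)} | i. i \<in> {1..m - 1}}
   \<union> {{(m, j), (m, j + 1), (1, n + 1 - j), (1, n - j)} | j. j \<in> {1..n - 1}}"

text \<open>Labelings are extensional, i.e. \<open>undefined\<close> off the vertex set, so that distinct
  labelings are distinct functions and can be counted.\<close>

definition c4_face_magic_labelings :: "nat \<Rightarrow> nat \<Rightarrow> nat \<Rightarrow> (nat \<times> nat \<Rightarrow> nat) set" where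
  "c4_face_magic_labelings m n S =
     {f \<in> extensional (pverts m n).
        bij_betw f (pverts m n) {1..m * n} \<and> (\<forall>F \<in> c4_faces m n. (\<Sum>v\<in>F. f v) = S)}"

definition psymmetries :: "nat \<Rightarrow> (nat \<times> nat \<Rightarrow> nat \<times> nat) set" where
  "psymmetries m =
     generate (BijGroup (pverts m m))
       {(\<lambda>(i, j)\<in>pverts m m. (m + 1 - j, i)), (\<lambda>(i, j)\<in>pverts m m. (i, m + 1 - j))}"

definition symmetry_rel ::
  "nat \<Rightarrow> nat \<Rightarrow> ((nat \<times> nat \<Rightarrow> nat) \<times> (nat \<times> nat \<Rightarrow> nat)) set" where
  "symmetry_rel m S =
     {(f, g). f \<in> c4_face_magic_labelings m m S \<and> g \<in> c4_face_magic_labelings m m S \<and>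
              (\<exists>\<sigma> \<in> psymmetries m. g = compose (pverts m m) f \<sigma>)}"

definition num_labelings_up_to_symmetry :: "nat \<Rightarrow> nat \<Rightarrow> nat" where
  "num_labelings_up_to_symmetry m S = card (c4_face_magic_labelings m m S // symmetry_rel m S)"

text \<open>A sequence \<open>(m\<^sub>1, n\<^sub>1, m\<^sub>2, n\<^sub>2, \<dots>)\<close> is a list with \<open>m\<^sub>i\<close> at (zero-based) index \<open>2 (i - 1)\<close>
  and \<open>n\<^sub>i\<close> at index \<open>2 (i - 1) + 1\<close>.\<close>

definition projective_factorization_seqs :: "nat \<Rightarrow> nat \<Rightarrow> nat list set" where
  "projective_factorization_seqs m n =
     {xs. (\<forall>x \<in> set xs. x > 1) \<and>
        (\<exists>k\<ge>1.
           (length xs = 2 * k \<and> m = (\<Prod>i<k. xs ! (2 * i)) \<and> n = (\<Prod>i<k. xs ! (2 * i + 1))) \<or>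
           (length xs = 2 * k + 1 \<and>
              m = (\<Prod>i<k + 1. xs ! (2 * i)) \<and> n = (\<Prod>i<k. xs ! (2 * i + 1))))}"

definition tau :: "nat \<Rightarrow> nat \<Rightarrow> nat" where
  "tau m n = card (projective_factorization_seqs m n)"

text \<open>Intended for odd \<open>m \<ge> 3\<close> only, where the divisions below are exact.\<close>

definition beta :: "nat \<Rightarrow> nat" where
  "beta m = (if m mod 4 = 1 then (fact ((m - 1) div 4))\<^sup>2
             else fact ((m - 3) div 4) * fact ((m + 1) div 4))"

end

theory Submission
  imports Defs "HOL-Combinatorics.Permutations"
begin

text \<open>
  A factorization sequence splits the mixed-radix digits of a number alternately into a row part
  and a column part. This gives \<open>a\<close> and \<open>b\<close> on \<open>{0..<m}\<close> such that \<open>a p + b q\<close> takes every value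
  below \<open>m\<^sup>2\<close> exactly once; as all factors are odd, \<open>a p\<close> and \<open>b p\<close> have the parity of \<open>p\<close>, and
  both \<open>a p + a (m - 1 - p)\<close> and \<open>b p + b (m - 1 - p)\<close> are constant. Placing \<open>a p + b q\<close> on the
  grid and then sending the even values increasingly to the upper half of \<open>{1..m\<^sup>2}\<close> and the odd
  values decreasingly to the lower half makes the contributions of \<open>a\<close> and \<open>b\<close> cancel around every
  4-cycle face, so the face sum is \<open>2 m\<^sup>2 + 1\<close>. The complementary labels have face sum
  \<open>2 m\<^sup>2 + 3\<close>.

  Rows and columns may be permuted by any permutation that preserves parity and commutes with the
  reversal \<open>p \<mapsto> m - 1 - p\<close>; there are \<open>2\<^bsup>(m-1)/2\<^esup> \<beta>(m)\<close> of these. Up to symmetry nothing is counted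
  twice: requiring 0 to go to the lower half rules out the reflections, and interchanging the axes
  is impossible because 1 is a value of \<open>a\<close> but not of \<open>b\<close>. The first factor is recovered as the
  least number that is not a value of \<open>a\<close>, so the sequence is determined by the two value sets.
\<close>

subsection \<open>Direct sums from factorization sequences\<close>

text \<open>The head is the first row factor and the tail is read with rows and columns exchanged;
  the mutual recursion encodes the alternation of row and column factors.\<close>

fun row_prod :: "nat list \<Rightarrow> nat" and col_prod :: "nat list \<Rightarrow> nat" where
  "row_prod [] = 1"
| "row_prod (x # xs) = x * col_prod xs"
| "col_prod [] = 1"
| "col_prod (x # xs) = row_prod xs"

text \<open>In mixed radix with digit sizes \<open>xs\<close>, lowest first, \<open>row_part\<close>
  spreads the digits of \<open>p\<close> over the places of even index and \<open>col_part\<close>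
  over those of odd index. The empty list returns 0, as only the argument 0 lies below the empty
  product 1.\<close>

fun row_part :: "nat list \<Rightarrow> nat \<Rightarrow> nat" and col_part :: "nat list \<Rightarrow> nat \<Rightarrow> nat" where
  "row_part [] p = 0"
| "row_part (x # xs) p = p mod x + x * col_part xs (p div x)"
| "col_part [] q = 0"
| "col_part (x # xs) q = x * row_part xs q"

lemma row_prod_col_prod_eq_prod:
  "row_prod xs = (\<Prod>i<(length xs + 1) div 2. xs ! (2 * i)) \<and>
   col_prod xs = (\<Prod>i<length xs div 2. xs ! (2 * i + 1))"
proof (induction xs)
  case Nil
  show ?case by simp
next
  case (Cons x xs)
  have "(length (x # xs) + 1) div 2 = Suc (length xs div 2)" by simp
  then show ?case using Cons by (simp add: prod.lessThan_Suc_shift del: prod.lessThan_Suc)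
qed

text \<open>Splitting off the lowest digit \<open>p mod x\<close> leaves \<open>x\<close> times the
  same kind of sum for the tail, with the two arguments in exchanged roles; hence the induction over
  arbitrary \<open>p\<close> and \<open>q\<close>.\<close>

lemma part_sum_less:
  "p < row_prod xs \<Longrightarrow> q < col_prod xs \<Longrightarrow>
   row_part xs p + col_part xs q < row_prod xs * col_prod xs"
proof (induction xs arbitrary: p q)
  case Nil
  then show ?case by simp
next
  case (Cons x xs)
  let ?t = "col_part xs (p div x) + row_part xs q"
  have x: "x > 0" using Cons.prems by (cases x) auto
  have "p div x < col_prod xs"
    using Cons.prems by (auto intro: less_mult_imp_div_less simp: mult.commute)
  with Cons.IH[of q "p div x"] Cons.prems have "Suc ?t \<le> row_prod xs * col_prod xs"
    by (simp add: add.commute)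
  then have "x * Suc ?t \<le> x * (row_prod xs * col_prod xs)" by (rule mult_le_mono2)
  moreover have "p mod x < x" using x by simp
  ultimately show ?case by (simp add: algebra_simps)
qed

text \<open>Reduction modulo \<open>x\<close> recovers the lowest digit, and cancelling it leaves
  the equation for the tail: this is uniqueness of digits in mixed radix.\<close>

lemma part_sum_inject:
  assumes "p < row_prod xs" "q < col_prod xs" "p' < row_prod xs" "q' < col_prod xs"
    and "row_part xs p + col_part xs q = row_part xs p' + col_part xs q'"
  shows "p = p' \<and> q = q'"
  using assms
proof (induction xs arbitrary: p q p' q')
  case Nil
  then show ?case by simp
next
  case (Cons x xs)
  have x: "x > 0" using Cons.prems by (cases x) auto
  let ?t = "row_part xs q + col_part xs (p div x)"
  let ?t' = "row_part xs q' + col_part xs (p' div x)"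
  have eq: "p mod x + x * ?t = p' mod x + x * ?t'"
    using Cons.prems(5) by (simp add: algebra_simps)
  have "(p mod x + x * ?t) mod x = (p' mod x + x * ?t') mod x" using eq by simp
  then have mods: "p mod x = p' mod x" by simp
  with eq x have t: "?t = ?t'" by simp
  have "p div x < col_prod xs" "p' div x < col_prod xs"
    using Cons.prems by (auto intro: less_mult_imp_div_less simp: mult.commute)
  then have "q = q' \<and> p div x = p' div x"
    using Cons.prems by (intro Cons.IH t) auto
  with mods show ?case by (metis div_mult_mod_eq)
qed

lemma row_part_zero: "row_part xs 0 = 0" and col_part_zero: "col_part xs 0 = 0"
proof -
  have "row_part xs 0 = 0 \<and> col_part xs 0 = 0" by (induction xs) auto
  then show "row_part xs 0 = 0" "col_part xs 0 = 0" by auto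
qed

text \<open>Odd products force every factor to be odd, so multiplying a digit by its place value
  keeps its parity; moving the digits to other places therefore changes nothing modulo 2.\<close>

lemma even_parts:
  assumes "odd (row_prod xs)" "odd (col_prod xs)"
  shows "(p < row_prod xs \<longrightarrow> even (row_part xs p) = even p) \<and>
         (p < col_prod xs \<longrightarrow> even (col_part xs p) = even p)"
  using assms
proof (induction xs arbitrary: p)
  case Nil
  then show ?case by simp
next
  case (Cons x xs)
  have x: "odd x" and IH: "p' < row_prod xs \<Longrightarrow> even (row_part xs p') = even p'"
    "p' < col_prod xs \<Longrightarrow> even (col_part xs p') = even p'" for p'
    using Cons by auto
  have "even (row_part (x # xs) p) = even p" if "p < row_prod (x # xs)"
  proof -
    have "p div x < col_prod xs"
      using that by (auto intro: less_mult_imp_div_less simp: mult.commute)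
    then have "even (col_part xs (p div x)) = even (p div x)" by (rule IH)
    moreover have "even p = even (p mod x + x * (p div x))" by simp
    ultimately show ?thesis using x by (simp only: row_part.simps even_add even_mult_iff)
  qed
  then show ?case using x IH by auto
qed

text \<open>Reversal replaces every digit by its complement to the largest digit, without carries.
  So the values at an argument and at its mirror image add up to the value whose digits are all
  maximal.\<close>

lemma part_reflect:
  "(p < row_prod xs \<longrightarrow>
      row_part xs p + row_part xs (row_prod xs - 1 - p) = row_part xs (row_prod xs - 1)) \<and>
   (p < col_prod xs \<longrightarrow>
      col_part xs p + col_part xs (col_prod xs - 1 - p) = col_part xs (col_prod xs - 1))"
proof (induction xs arbitrary: p)
  case Nil
  then show ?case by simp
next
  case (Cons x xs)
  have "row_part (x # xs) p + row_part (x # xs) (row_prod (x # xs) - 1 - p)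
      = row_part (x # xs) (row_prod (x # xs) - 1)" if "p < row_prod (x # xs)"
  proof -
    define c r d where "c = col_prod xs" and "r = p mod x" and "d = p div x"
    have x: "x > 0" using that by (cases x) auto
    have p: "p = x * d + r" and r: "r < x" using x by (auto simp: r_def d_def)
    have d: "d < c" using that unfolding c_def d_def
      by (auto intro: less_mult_imp_div_less simp: mult.commute)
    \<comment> \<open>Uses
      \<open>x * c - 1 - (x * d' + r') = x * (c - 1 - d') + (x - 1 - r')\<close>, written with
      \<open>e\<close> and \<open>s\<close> for the differences.\<close>
    have reflect: "(x * c - 1 - (x * d' + r')) div x = c - 1 - d' \<and>
        (x * c - 1 - (x * d' + r')) mod x = x - 1 - r'" if "r' < x" "d' < c" for r' d'
    proof -
      obtain e where "c = Suc (d' + e)" using \<open>d' < c\<close> less_iff_Suc_add by blast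
      moreover obtain s where "x = Suc (r' + s)" using \<open>r' < x\<close> less_iff_Suc_add by blast
      ultimately have "x * c - 1 - (x * d' + r') = x * e + s" "e = c - 1 - d'" "s = x - 1 - r'" "s < x"
        by (simp_all add: algebra_simps)
      then show ?thesis by simp
    qed
    have "col_part xs d + col_part xs (c - 1 - d) = col_part xs (c - 1)"
      using Cons d by (simp add: c_def)
    moreover have "(x * c - 1) div x = c - 1" "(x * c - 1) mod x = x - 1"
      using reflect[of 0 0] x d by auto
    moreover have "(x * c - 1 - p) div x = c - 1 - d" "(x * c - 1 - p) mod x = x - 1 - r"
      using reflect[of r d] r d p by auto
    moreover have "r + x * u + (x - 1 - r + x * v) = x - 1 + x * (u + v)" for u v
      using r by (simp add: distrib_left)
    ultimately show ?thesis
      by (simp only: row_part.simps row_prod.simps c_def[symmetric] r_def[symmetric] d_def[symmetric])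
  qed
  moreover have "col_part (x # xs) p + col_part (x # xs) (col_prod (x # xs) - 1 - p)
      = col_part (x # xs) (col_prod (x # xs) - 1)" if "p < col_prod (x # xs)"
    using Cons that by (simp flip: distrib_left)
  ultimately show ?case by blast
qed

section \<open>Recovering the sequence from its value sets\<close>

definition row_set :: "nat list \<Rightarrow> nat set" where
  "row_set xs = row_part xs ` {..<row_prod xs}"

definition col_set :: "nat list \<Rightarrow> nat set" where
  "col_set xs = col_part xs ` {..<col_prod xs}"

lemma row_set_Nil: "row_set [] = {0}" and col_set_Nil: "col_set [] = {0}"
  by (auto simp: row_set_def col_set_def)

lemma col_set_Cons: "col_set (x # xs) = (*) x ` row_set xs"
  by (auto simp: row_set_def col_set_def)

text \<open>The lowest digit is free: a row value may have any remainder modulo \<open>x\<close>,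
  and only its quotient is constrained, by the tail with roles exchanged.\<close>

lemma mem_row_set_Cons:
  assumes "x > 0"
  shows "n \<in> row_set (x # xs) \<longleftrightarrow> n div x \<in> col_set xs"
proof
  assume "n \<in> row_set (x # xs)"
  then obtain p where p: "p < x * col_prod xs" "n = p mod x + x * col_part xs (p div x)"
    by (auto simp: row_set_def)
  then have "n div x = col_part xs (p div x)" using assms by simp
  moreover have "p div x < col_prod xs"
    using p by (auto intro: less_mult_imp_div_less simp: mult.commute)
  ultimately show "n div x \<in> col_set xs" by (auto simp: col_set_def)
next
  assume "n div x \<in> col_set xs"
  then obtain d where d: "d < col_prod xs" "n div x = col_part xs d" by (auto simp: col_set_def)
  define p where "p = x * d + n mod x"
  have "p < x * Suc d" using assms by (simp add: p_def)
  also have "\<dots> \<le> x * col_prod xs" using d by (intro mult_le_mono2) simp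
  finally have "p < row_prod (x # xs)" by simp
  moreover have "row_part (x # xs) p = n"
    using assms d(2)[symmetric] by (simp add: p_def)
  ultimately show "n \<in> row_set (x # xs)" unfolding row_set_def by (metis imageI lessThan_iff)
qed

text \<open>Every column value is a multiple of the first factor, whereas the row values of a
  nonempty sequence include 1. This contrast later excludes the symmetries that exchange the
  axes.\<close>

lemma one_notin_col_set:
  assumes "\<forall>x\<in>set xs. x > 1"
  shows "1 \<notin> col_set xs"
proof (cases xs)
  case (Cons x ys)
  then have "x \<noteq> 1" using assms by auto
  then have "x * n \<noteq> 1" for n by (metis nat_mult_eq_1_iff)
  then show ?thesis unfolding Cons col_set_Cons by (metis imageE)
qed (simp add: col_set_Nil)

lemma zero_in_sets:
  assumes "\<forall>x\<in>set xs. x > 1"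
  shows "0 \<in> row_set xs" "0 \<in> col_set xs"
proof -
  have "row_prod xs > 0 \<and> col_prod xs > 0" using assms by (induction xs) auto
  then show "0 \<in> row_set xs" "0 \<in> col_set xs"
    using image_eqI[of 0 "row_part xs" 0] image_eqI[of 0 "col_part xs" 0]
    by (auto simp: row_set_def col_set_def row_part_zero col_part_zero)
qed

lemma one_in_row_set:
  assumes "\<forall>x\<in>set xs. x > 1" "xs \<noteq> []"
  shows "1 \<in> row_set xs"
proof (cases xs)
  case (Cons x ys)
  then show ?thesis using assms zero_in_sets(2)[of ys] by (simp add: mem_row_set_Cons)
qed (use assms in simp)

text \<open>Below \<open>x\<close> the quotient is 0, a column value of the tail; at
  \<open>x\<close> it is 1, which never is one.\<close>

lemma Least_notin_row_set:
  assumes "\<forall>y\<in>set (x # xs). y > 1"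
  shows "(LEAST n. n \<notin> row_set (x # xs)) = x"
proof (rule Least_equality)
  show "x \<notin> row_set (x # xs)"
    using assms one_notin_col_set[of xs] by (simp add: mem_row_set_Cons)
  show "x \<le> n" if "n \<notin> row_set (x # xs)" for n
    using that assms zero_in_sets(2)[of xs] by (cases "n < x") (auto simp: mem_row_set_Cons)
qed

text \<open>The first factor is read off the row values; dividing by it turns the row set into the
  column set of the tail and the column set into its row set, and induction applies.\<close>

lemma row_set_col_set_inject:
  assumes "\<forall>x\<in>set xs. x > 1" "\<forall>y\<in>set ys. y > 1"
    and "row_set xs = row_set ys" "col_set xs = col_set ys"
  shows "xs = ys"
  using assms
proof (induction xs arbitrary: ys)
  case Nil
  then have "1 \<notin> row_set ys" by (metis row_set_Nil singletonD zero_neq_one)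
  then show ?case using one_in_row_set Nil.prems(2) by blast
next
  case (Cons x xs)
  have "1 \<in> row_set ys" using Cons.prems one_in_row_set[of "x # xs"] by simp
  then obtain y zs where ys: "ys = y # zs" by (cases ys) (auto simp: row_set_Nil)
  have xy: "x = y"
    using Cons.prems Least_notin_row_set[of x xs] Least_notin_row_set[of y zs] ys by simp
  have x: "x > 0" using Cons.prems by auto
  have "n \<in> col_set xs \<longleftrightarrow> n \<in> col_set zs" for n
    using Cons.prems(3) mem_row_set_Cons[OF x, of "n * x" xs] mem_row_set_Cons[OF x, of "n * x" zs]
      x ys xy by simp
  moreover have "row_set xs = row_set zs"
  proof -
    have "inj ((*) x)" using x by (auto intro: injI)
    then show ?thesis using Cons.prems(4) unfolding ys xy[symmetric] col_set_Cons
      by (simp add: inj_image_eq_iff)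
  qed
  ultimately have "xs = zs" using Cons.prems ys by (intro Cons.IH) auto
  then show ?case using xy ys by simp
qed

lemma projective_factorization_seqsD:
  assumes "xs \<in> projective_factorization_seqs m n"
  shows "\<forall>x\<in>set xs. x > 1" "xs \<noteq> []" "row_prod xs = m" "col_prod xs = n"
proof -
  from assms obtain k where k: "k \<ge> 1" and
    "(length xs = 2 * k \<and> m = (\<Prod>i<k. xs ! (2 * i)) \<and> n = (\<Prod>i<k. xs ! (2 * i + 1))) \<or>
     (length xs = 2 * k + 1 \<and> m = (\<Prod>i<k + 1. xs ! (2 * i)) \<and> n = (\<Prod>i<k. xs ! (2 * i + 1)))"
    unfolding projective_factorization_seqs_def by blast
  then have "row_prod xs = m \<and> col_prod xs = n \<and> length xs > 0"
  proof (elim disjE conjE)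
    assume *: "length xs = 2 * k" "m = (\<Prod>i<k. xs ! (2 * i))" "n = (\<Prod>i<k. xs ! (2 * i + 1))"
    then have "(length xs + 1) div 2 = k" "length xs div 2 = k" by simp_all
    with row_prod_col_prod_eq_prod[of xs] * k show ?thesis by simp
  next
    assume *: "length xs = 2 * k + 1" "m = (\<Prod>i<k + 1. xs ! (2 * i))"
      "n = (\<Prod>i<k. xs ! (2 * i + 1))"
    then have "(length xs + 1) div 2 = k + 1" "length xs div 2 = k" by simp_all
    with row_prod_col_prod_eq_prod[of xs] * show ?thesis by simp
  qed
  then show "xs \<noteq> []" "row_prod xs = m" "col_prod xs = n" by auto
  show "\<forall>x\<in>set xs. x > 1" using assms by (simp add: projective_factorization_seqs_def)
qed

subsection \<open>Parity-preserving mirror-symmetric permutations\<close>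

text \<open>For odd \<open>m \<ge> 3\<close> mirror symmetry fixes the middle position, so exactly
  one of a permutation and its reversal sends 0 below the middle; the last condition picks that
  one.\<close>

definition mirror_perms :: "nat \<Rightarrow> (nat \<Rightarrow> nat) set" where
  "mirror_perms m =
     {\<pi>. \<pi> permutes {..<m} \<and> (\<forall>p<m. even (\<pi> p) = even p) \<and>
         (\<forall>p<m. \<pi> (m - 1 - p) = m - 1 - \<pi> p) \<and> \<pi> 0 < (m - 1) div 2}"

text \<open>Permutations of the even and of the odd numbers below \<open>h\<close> have disjoint
  supports, so their composite acts as one factor on each parity class and determines both.\<close>

lemma card_parity_perms:
  "fact ((h + 1) div 2) * fact (h div 2)
     \<le> card {\<rho>. \<rho> permutes {..<h} \<and> (\<forall>p. even (\<rho> p) = even p)}"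
    (is "_ \<le> card ?R")
proof -
  let ?E = "{p. p < h \<and> even p}" and ?O = "{p. p < h \<and> odd p}"
  have cards: "card ?E = (h + 1) div 2 \<and> card ?O = h div 2"
  proof (induction h)
    case (Suc h)
    have "{p. p < Suc h \<and> even p} = (if even h then insert h {p. p < h \<and> even p} else {p. p < h \<and> even p})"
      "{p. p < Suc h \<and> odd p} = (if odd h then insert h {p. p < h \<and> odd p} else {p. p < h \<and> odd p})"
      by (auto simp: less_Suc_eq)
    then show ?case using Suc by auto
  qed simp
  let ?D = "{\<sigma>. \<sigma> permutes ?E} \<times> {\<tau>. \<tau> permutes ?O}"
  have even_val: "even (\<sigma> p)" if "\<sigma> permutes ?E" "even p" for \<sigma> p
  proof (cases "p \<in> ?E")
    case True
    then have "\<sigma> p \<in> ?E" using that(1) permutes_in_image by metis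
    then show ?thesis by simp
  qed (use that in \<open>simp add: permutes_not_in\<close>)
  have odd_val: "odd (\<tau> p)" if "\<tau> permutes ?O" "odd p" for \<tau> p
  proof (cases "p \<in> ?O")
    case True
    then have "\<tau> p \<in> ?O" using that(1) permutes_in_image by metis
    then show ?thesis by simp
  qed (use that in \<open>simp add: permutes_not_in\<close>)
  have vals: "(\<sigma> \<circ> \<tau>) p = (if even p then \<sigma> p else \<tau> p)"
    if "\<sigma> permutes ?E" "\<tau> permutes ?O" for \<sigma> \<tau> p
    using permutes_not_in[OF that(1), of "\<tau> p"] permutes_not_in[OF that(2), of p] odd_val[OF that(2), of p]
    by simp
  have inj: "inj_on (\<lambda>(\<sigma>, \<tau>). \<sigma> \<circ> \<tau>) ?D"
  proof (rule inj_onI, clarify)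
    fix \<sigma> \<tau> \<sigma>' \<tau>'
    assume *: "\<sigma> permutes ?E" "\<tau> permutes ?O" "\<sigma>' permutes ?E" "\<tau>' permutes ?O" "\<sigma> \<circ> \<tau> = \<sigma>' \<circ> \<tau>'"
    have eq: "(if even p then \<sigma> p else \<tau> p) = (if even p then \<sigma>' p else \<tau>' p)" for p
      using vals[of \<sigma> \<tau> p] vals[of \<sigma>' \<tau>' p] * by simp
    have "\<sigma> p = \<sigma>' p" for p
      using eq[of p] *(1,3) by (cases "even p") (auto simp: permutes_not_in)
    moreover have "\<tau> p = \<tau>' p" for p
      using eq[of p] *(2,4) by (cases "even p") (auto simp: permutes_not_in)
    ultimately show "\<sigma> = \<sigma>' \<and> \<tau> = \<tau>'" by auto
  qed
  have sub: "(\<lambda>(\<sigma>, \<tau>). \<sigma> \<circ> \<tau>) ` ?D \<subseteq> ?R"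
  proof clarify
    fix \<sigma> \<tau>
    assume *: "\<sigma> permutes ?E" "\<tau> permutes ?O"
    have "\<sigma> permutes {..<h}" "\<tau> permutes {..<h}"
      by (rule permutes_subset[OF *(1)], auto) (rule permutes_subset[OF *(2)], auto)
    then have "\<sigma> \<circ> \<tau> permutes {..<h}" by (simp add: permutes_compose)
    moreover have "even ((\<sigma> \<circ> \<tau>) p) = even p" for p
      using vals[OF *, of p] even_val[OF *(1)] odd_val[OF *(2)] by simp
    ultimately show "\<sigma> \<circ> \<tau> permutes {..<h} \<and> (\<forall>p. even ((\<sigma> \<circ> \<tau>) p) = even p)" by blast
  qed
  have "finite ?R" by (rule finite_subset[OF _ finite_permutations[of "{..<h}"]]) auto
  then have "card ?D \<le> card ?R" using card_inj_on_le[OF inj sub] by simp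
  moreover have "card ?D = fact ((h + 1) div 2) * fact (h div 2)"
    using cards by (simp add: card_cartesian_product card_permutations)
  ultimately show ?thesis by simp
qed

text \<open>A signed permutation: \<open>\<rho>\<close> acts on the lower half, \<open>T\<close>
  marks the positions there whose image is reflected about \<open>h\<close>, and mirror symmetry
  dictates the upper half. Arguments above \<open>2 * h\<close> are fixed, as
  \<open>permutes\<close> demands.\<close>

definition signed_perm :: "nat \<Rightarrow> (nat \<Rightarrow> nat) \<Rightarrow> nat set \<Rightarrow> nat \<Rightarrow> nat" where
  "signed_perm h \<rho> T p =
     (if p \<le> h then (if p \<in> T then 2 * h - \<rho> p else \<rho> p)
      else if p \<le> 2 * h then (if 2 * h - p \<in> T then \<rho> (2 * h - p) else 2 * h - \<rho> (2 * h - p))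
      else p)"

text \<open>Reflection about \<open>h\<close> keeps parity because it subtracts from an even number.
  Choosing \<open>T\<close> without 0 keeps the image of 0 in the lower half and leaves
  \<open>h - 1\<close> free signs.\<close>

lemma card_mirror_perms:
  assumes "h \<ge> 1"
  shows "fact ((h + 1) div 2) * fact (h div 2) * 2 ^ (h - 1) \<le> card (mirror_perms (2 * h + 1))"
proof -
  let ?R = "{\<rho>. \<rho> permutes {..<h} \<and> (\<forall>p. even (\<rho> p) = even p)}"
  let ?D = "?R \<times> Pow {1..<h}"
  let ?G = "\<lambda>(\<rho>, T). signed_perm h \<rho> T"
  have bound: "\<rho> p < h \<longleftrightarrow> p < h" if "\<rho> permutes {..<h}" for \<rho> p
    using permutes_in_image[OF that, of p] by simp
  have fix_h: "\<rho> h = h" if "\<rho> permutes {..<h}" for \<rho>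
    using permutes_not_in[OF that, of h] by simp
  have inj: "inj_on ?G ?D"
  proof (rule inj_onI, clarify)
    fix \<rho> T \<rho>' T'
    assume *: "\<rho> permutes {..<h}" "\<rho>' permutes {..<h}" "T \<subseteq> {1..<h}" "T' \<subseteq> {1..<h}"
      "signed_perm h \<rho> T = signed_perm h \<rho>' T'"
    \<comment> \<open>Whether the value lies below or above \<open>h\<close> reveals the sign;
      undoing the sign then reveals \<open>\<rho> p\<close>.\<close>
    have both: "\<rho> p = \<rho>' p \<and> (p \<in> T \<longleftrightarrow> p \<in> T')" if "p < h" for p
    proof -
      have "\<rho> p < h" "\<rho>' p < h" using bound[OF *(1), of p] bound[OF *(2), of p] that by auto
      then show ?thesis using fun_cong[OF *(5), of p] that
        by (auto simp: signed_perm_def split: if_splits)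
    qed
    have "\<rho> p = \<rho>' p" for p
      using both[of p] permutes_not_in[OF *(1), of p] permutes_not_in[OF *(2), of p]
      by (cases "p < h") auto
    moreover have "p \<in> T \<longleftrightarrow> p \<in> T'" for p
      using both[of p] *(3,4) by (cases "p < h") auto
    ultimately show "\<rho> = \<rho>' \<and> T = T'" by auto
  qed
  have mem: "signed_perm h \<rho> T \<in> mirror_perms (2 * h + 1)"
    if "\<rho> permutes {..<h}" "\<forall>p. even (\<rho> p) = even p" "T \<subseteq> {1..<h}" for \<rho> T
  proof -
    let ?g = "signed_perm h \<rho> T"
    have le: "\<rho> p \<le> h" if "p \<le> h" for p
      using bound[OF \<open>\<rho> permutes {..<h}\<close>, of p] fix_h[OF \<open>\<rho> permutes {..<h}\<close>] that
      by (cases "p = h") auto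
    have hT: "h \<notin> T" using that(3) by auto
    have mirror: "?g (2 * h - p) = 2 * h - ?g p" if "p \<le> 2 * h" for p
      using le[of p] le[of "2 * h - p"] that hT fix_h[OF \<open>\<rho> permutes {..<h}\<close>]
      by (cases p h rule: linorder_cases) (auto simp: signed_perm_def)
    have g_le: "?g p \<le> 2 * h" if "p \<le> 2 * h" for p
    proof (cases "p \<le> h")
      case False
      then have "\<rho> (2 * h - p) \<le> h" by (intro le) simp
      then show ?thesis using False that by (auto simp: signed_perm_def)
    qed (use le[of p] in \<open>auto simp: signed_perm_def\<close>)
    \<comment> \<open>Up to reflection the value on the lower half is \<open>\<rho> p\<close>, which
      is at most \<open>h\<close>, so the value and its mirror image determine it alike.\<close>
    have inj_half: "p = p'" if "p \<le> h" "p' \<le> h" "?g p = ?g p' \<or> ?g p = 2 * h - ?g p'" for p p'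
    proof -
      have "\<rho> p = \<rho> p'" using that le[of p] le[of p'] by (auto simp: signed_perm_def split: if_splits)
      then show ?thesis using permutes_inj[OF \<open>\<rho> permutes {..<h}\<close>] by (simp add: inj_eq)
    qed
    have fold: "\<exists>q\<le>h. (p = q \<and> ?g p = ?g q) \<or> (q < h \<and> p = 2 * h - q \<and> ?g p = 2 * h - ?g q)"
      if "p \<le> 2 * h" for p
    proof (cases "p \<le> h")
      case False
      then show ?thesis using that mirror[of "2 * h - p"]
        by (intro exI[of _ "2 * h - p"]) auto
    qed auto
    have not_h: "?g q \<noteq> h" if "q < h" for q
      using bound[OF \<open>\<rho> permutes {..<h}\<close>, of q] that by (auto simp: signed_perm_def)
    have inj_g: "inj_on ?g {..<2 * h + 1}"
    proof (rule inj_onI)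
      fix p p' assume p: "p \<in> {..<2 * h + 1}" "p' \<in> {..<2 * h + 1}" and eq: "?g p = ?g p'"
      obtain q where q: "q \<le> h" "(p = q \<and> ?g p = ?g q) \<or> (q < h \<and> p = 2 * h - q \<and> ?g p = 2 * h - ?g q)"
        using fold[of p] p by auto
      obtain q' where q': "q' \<le> h" "(p' = q' \<and> ?g p' = ?g q') \<or> (q' < h \<and> p' = 2 * h - q' \<and> ?g p' = 2 * h - ?g q')"
        using fold[of p'] p by auto
      have "?g q = ?g q' \<or> ?g q = 2 * h - ?g q'"
        using q(2) q'(2) eq g_le[of q] g_le[of q'] q(1) q'(1)
        by (metis diff_diff_cancel mult_2 trans_le_add1)
      then have "q = q'" using inj_half q(1) q'(1) by blast
      \<comment> \<open>No value off the middle is its own mirror image, so a position and its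
        mirror cannot share a value.\<close>
      moreover have "2 * h - ?g q \<noteq> ?g q" if "q < h"
        using not_h[OF that] g_le[of q] that by linarith
      ultimately show "p = p'" using q(2) q'(2) eq by metis
    qed
    have "?g p < 2 * h + 1" if "p < 2 * h + 1" for p using g_le[of p] that by linarith
    then have "?g ` {..<2 * h + 1} \<subseteq> {..<2 * h + 1}" by blast
    then have "bij_betw ?g {..<2 * h + 1} {..<2 * h + 1}"
      using inj_g by (simp add: bij_betw_def endo_inj_surj)
    then have "?g permutes {..<2 * h + 1}"
      by (rule bij_imp_permutes) (simp add: signed_perm_def)
    moreover have "even (?g p) = even p" if "p \<le> 2 * h" for p
    proof -
      have even_refl: "even (2 * h - k) = even k" if "k \<le> 2 * h" for k :: nat
        using that by simp
      have even_\<rho>: "even (\<rho> k) = even k" for k using \<open>\<forall>p. even (\<rho> p) = even p\<close> by blast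
      show ?thesis
      proof (cases "p \<le> h")
        case True
        then have "\<rho> p \<le> 2 * h" using le[of p] by simp
        then show ?thesis using True by (simp add: signed_perm_def even_refl even_\<rho> del: even_diff_nat)
      next
        case False
        then have "\<rho> (2 * h - p) \<le> h" by (intro le) simp
        then have "\<rho> (2 * h - p) \<le> 2 * h" by simp
        then show ?thesis using False that
          by (simp add: signed_perm_def even_refl even_\<rho> del: even_diff_nat)
      qed
    qed
    moreover have "?g 0 < h"
      using bound[OF \<open>\<rho> permutes {..<h}\<close>, of 0] assms that(3) by (auto simp: signed_perm_def)
    ultimately show ?thesis using mirror by (simp add: mirror_perms_def less_Suc_eq_le)
  qed
  have "finite (mirror_perms (2 * h + 1))"
    by (rule finite_subset[OF _ finite_permutations[of "{..<2 * h + 1}"]])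
      (auto simp: mirror_perms_def)
  moreover have "?G ` ?D \<subseteq> mirror_perms (2 * h + 1)" using mem by auto
  ultimately have "card ?D \<le> card (mirror_perms (2 * h + 1))" using card_inj_on_le[OF inj] by blast
  moreover have "card ?D = card ?R * 2 ^ (h - 1)"
    by (simp add: card_cartesian_product card_Pow)
  ultimately show ?thesis 
    using mult_le_mono1[OF card_parity_perms[of h], of "2 ^ (h - 1)"] by linarith
qed

subsection \<open>Face sums of folded grid sums\<close>

definition grid_labeling ::
  "nat \<Rightarrow> (nat \<Rightarrow> nat) \<Rightarrow> (nat \<Rightarrow> nat) \<Rightarrow> (nat \<Rightarrow> nat) \<Rightarrow> nat \<times> nat \<Rightarrow> nat" where
  "grid_labeling m F a b = (\<lambda>(i, j)\<in>pverts m m. F (a (i - 1) + b (j - 1)))"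

lemma grid_labeling_apply:
  "i \<in> {1..m} \<Longrightarrow> j \<in> {1..m} \<Longrightarrow> grid_labeling m F a b (i, j) = F (a (i - 1) + b (j - 1))"
  by (simp add: grid_labeling_def pverts_def)

text \<open>Doubling avoids halves in the label formula; \<open>e = 1\<close> and
  \<open>e = - 1\<close> will serve the two face sums. Each face has two vertices of either parity,
  giving \<open>2 * (c + c')\<close> for the doubled sum once the terms in \<open>e\<close>
  cancel.\<close>

lemma grid_labeling_magic:
  fixes c c' e :: int
  assumes m: "odd m" "m \<ge> 3"
    and even_a: "\<And>p. p < m \<Longrightarrow> even (a p) = even p"
    and even_b: "\<And>p. p < m \<Longrightarrow> even (b p) = even p"
    and refl_a: "\<And>p. p < m \<Longrightarrow> a p + a (m - 1 - p) = s"
    and refl_b: "\<And>p. p < m \<Longrightarrow> b p + b (m - 1 - p) = t"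
    and bij: "bij_betw (\<lambda>(p, q). a p + b q) ({..<m} \<times> {..<m}) {..<m * m}"
    and bij_F: "bij_betw F {..<m * m} {1..m * m}"
    and F: "\<And>d. d < m * m \<Longrightarrow> 2 * int (F d) = (if even d then c + e * int d else c' - e * int d)"
    and S: "int S = c + c'"
  shows "grid_labeling m F a b \<in> c4_face_magic_labelings m m S"
proof -
  let ?f = "grid_labeling m F a b"
  define A where "A i = int (a (i - 1))" for i
  define B where "B j = int (b (j - 1))" for j
  have bound: "a p + b q < m * m" if "p < m" "q < m" for p q
    using bij_betwE[OF bij] that by auto
  have val: "2 * int (?f (i, j)) = (if even (i + j) then c + e * (A i + B j) else c' - e * (A i + B j))"
    if "i \<in> {1..m}" "j \<in> {1..m}" for i j
  proof -
    have lt: "i - 1 < m" "j - 1 < m" using that by auto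
    have "even (i - 1) = odd i" "even (j - 1) = odd j" using that by auto
    then have "even (a (i - 1) + b (j - 1)) = even (i + j)"
      using even_a[OF lt(1)] even_b[OF lt(2)] by simp
    then show ?thesis using F[OF bound[OF lt]] that
      by (simp add: grid_labeling_apply A_def B_def)
  qed
  have A_refl: "A (m + 1 - i) = int s - A i" if "i \<in> {1..m}" for i
  proof -
    have "i - 1 < m" "m - 1 - (i - 1) = m + 1 - i - 1" using that by auto
    then have "a (i - 1) + a (m + 1 - i - 1) = s" using refl_a[of "i - 1"] by metis
    then show ?thesis by (auto simp: A_def)
  qed
  have B_refl: "B (m + 1 - j) = int t - B j" if "j \<in> {1..m}" for j
  proof -
    have "j - 1 < m" "m - 1 - (j - 1) = m + 1 - j - 1" using that by auto
    then have "b (j - 1) + b (m + 1 - j - 1) = t" using refl_b[of "j - 1"] by metis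
    then show ?thesis by (auto simp: B_def)
  qed
  have shift: "bij_betw (\<lambda>(i, j). (i - 1, j - 1)) (pverts m m) ({..<m} \<times> {..<m})"
    by (rule bij_betw_byWitness[where f' = "\<lambda>(p, q). (p + 1, q + 1)"]) (auto simp: pverts_def)
  have "bij_betw (F \<circ> ((\<lambda>(p, q). a p + b q) \<circ> (\<lambda>(i, j). (i - 1, j - 1)))) (pverts m m) {1..m * m}"
    using bij_betw_trans[OF bij_betw_trans[OF shift bij] bij_F] .
  then have bij_f: "bij_betw ?f (pverts m m) {1..m * m}"
    by (rule bij_betw_cong[THEN iffD1, rotated]) (auto simp: grid_labeling_def)
  have "(\<Sum>v\<in>{(i, j), (i + 1, j), (i, j + 1), (i + 1, j + 1)}. ?f v) = S"
    if "i \<in> {1..m - 1}" "j \<in> {1..m - 1}" for i j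
  proof -
    have mem: "i \<in> {1..m}" "i + 1 \<in> {1..m}" "j \<in> {1..m}" "j + 1 \<in> {1..m}"
      using that by auto
    \<comment> \<open>Diagonal pairs share parity, so every term in \<open>A\<close> and
      \<open>B\<close> occurs once with each sign.\<close>
    have "2 * int (?f (i, j) + ?f (i + 1, j) + ?f (i, j + 1) + ?f (i + 1, j + 1)) = 2 * int S"
      using val[OF mem(1,3)] val[OF mem(2,3)] val[OF mem(1,4)] val[OF mem(2,4)]
      by (cases "even (i + j)") (simp_all add: S algebra_simps)
    then show ?thesis by simp
  qed
  moreover have "(\<Sum>v\<in>{(i, m), (i + 1, m), (m + 1 - i, 1), (m - i, 1)}. ?f v) = S"
    if "i \<in> {1..m - 1}" for i
  proof -
    \<comment> \<open>Vertices joined across the seam have equal parity, and by reflection their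
      \<open>A\<close> terms add up to \<open>s\<close>; both seam pairs thus carry
      \<open>s + B m + B 1\<close>, with opposite signs.\<close>
    have parity: "even (m + 1 - i + 1) = even (i + m)" "even (m - i + 1) = even (i + 1 + m)"
      using that m by auto
    have mem: "i \<in> {1..m}" "i + 1 \<in> {1..m}" "m + 1 - i \<in> {1..m}" "m - i \<in> {1..m}"
      "m \<in> {1..m}" "1 \<in> {1..m}"
      using that m by auto
    have A': "A (m + 1 - i) = int s - A i" "A (m - i) = int s - A (i + 1)"
      using A_refl[OF mem(1)] A_refl[OF mem(2)] by simp_all
    have "2 * int (?f (i, m) + ?f (i + 1, m) + ?f (m + 1 - i, 1) + ?f (m - i, 1)) = 2 * int S"
    proof (cases "even (i + m)")
      case True
      have "2 * int (?f (i, m)) = c + e * (A i + B m)"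
        "2 * int (?f (i + 1, m)) = c' - e * (A (i + 1) + B m)"
        "2 * int (?f (m + 1 - i, 1)) = c + e * (int s - A i + B 1)"
        "2 * int (?f (m - i, 1)) = c' - e * (int s - A (i + 1) + B 1)"
        using val[OF mem(1,5)] val[OF mem(2,5)] val[OF mem(3,6)] val[OF mem(4,6)] True
        unfolding parity A' by simp_all
      then show ?thesis by (simp add: S algebra_simps)
    next
      case False
      have "2 * int (?f (i, m)) = c' - e * (A i + B m)"
        "2 * int (?f (i + 1, m)) = c + e * (A (i + 1) + B m)"
        "2 * int (?f (m + 1 - i, 1)) = c' - e * (int s - A i + B 1)"
        "2 * int (?f (m - i, 1)) = c + e * (int s - A (i + 1) + B 1)"
        using val[OF mem(1,5)] val[OF mem(2,5)] val[OF mem(3,6)] val[OF mem(4,6)] False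
        unfolding parity A' by simp_all
      then show ?thesis by (simp add: S algebra_simps)
    qed
    \<comment> \<open>Faces are sets, so the four vertices must be distinct for the sum to
      split.\<close>
    moreover have "m + 1 - i \<noteq> m - i" "m \<noteq> 1" using that m by auto
    ultimately show ?thesis by simp
  qed
  moreover have "(\<Sum>v\<in>{(m, j), (m, j + 1), (1, m + 1 - j), (1, m - j)}. ?f v) = S"
    if "j \<in> {1..m - 1}" for j
  proof -
    have parity: "even (1 + (m + 1 - j)) = even (m + j)" "even (1 + (m - j)) = even (m + (j + 1))"
      using that m by auto
    have mem: "j \<in> {1..m}" "j + 1 \<in> {1..m}" "m + 1 - j \<in> {1..m}" "m - j \<in> {1..m}"
      "m \<in> {1..m}" "1 \<in> {1..m}"
      using that m by auto
    have B': "B (m + 1 - j) = int t - B j" "B (m - j) = int t - B (j + 1)"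
      using B_refl[OF mem(1)] B_refl[OF mem(2)] by simp_all
    have "2 * int (?f (m, j) + ?f (m, j + 1) + ?f (1, m + 1 - j) + ?f (1, m - j)) = 2 * int S"
    proof (cases "even (m + j)")
      case True
      have "2 * int (?f (m, j)) = c + e * (A m + B j)"
        "2 * int (?f (m, j + 1)) = c' - e * (A m + B (j + 1))"
        "2 * int (?f (1, m + 1 - j)) = c + e * (A 1 + (int t - B j))"
        "2 * int (?f (1, m - j)) = c' - e * (A 1 + (int t - B (j + 1)))"
        using val[OF mem(5,1)] val[OF mem(5,2)] val[OF mem(6,3)] val[OF mem(6,4)] True
        unfolding parity B' by simp_all
      then show ?thesis by (simp add: S algebra_simps)
    next
      case False
      have "2 * int (?f (m, j)) = c' - e * (A m + B j)"
        "2 * int (?f (m, j + 1)) = c + e * (A m + B (j + 1))"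
        "2 * int (?f (1, m + 1 - j)) = c' - e * (A 1 + (int t - B j))"
        "2 * int (?f (1, m - j)) = c + e * (A 1 + (int t - B (j + 1)))"
        using val[OF mem(5,1)] val[OF mem(5,2)] val[OF mem(6,3)] val[OF mem(6,4)] False
        unfolding parity B' by simp_all
      then show ?thesis by (simp add: S algebra_simps)
    qed
    moreover have "m + 1 - j \<noteq> m - j" "m \<noteq> 1" using that m by auto
    ultimately show ?thesis by simp
  qed
  ultimately have "\<forall>V\<in>c4_faces m m. (\<Sum>v\<in>V. ?f v) = S"
    unfolding c4_faces_def by blast
  moreover have "?f \<in> extensional (pverts m m)" by (simp add: grid_labeling_def)
  ultimately show ?thesis using bij_f by (simp add: c4_face_magic_labelings_def)
qed

subsection \<open>Symmetries of the square grid\<close>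

definition axis_reflection :: "nat \<Rightarrow> (nat \<Rightarrow> nat) \<Rightarrow> bool" where
  "axis_reflection m e \<longleftrightarrow> (\<forall>i\<in>{1..m}. e i = i) \<or> (\<forall>i\<in>{1..m}. e i = m + 1 - i)"

lemma reflect_index:
  "i \<in> {1..m} \<Longrightarrow> m + 1 - i \<in> {1..m}" "i \<in> {1..m} \<Longrightarrow> m + 1 - (m + 1 - i) = i" for i m :: nat
  by auto

lemma axis_reflection_mem: "axis_reflection m e \<Longrightarrow> i \<in> {1..m} \<Longrightarrow> e i \<in> {1..m}"
  and axis_reflection_involution: "axis_reflection m e \<Longrightarrow> i \<in> {1..m} \<Longrightarrow> e (e i) = i"
  unfolding axis_reflection_def by (metis reflect_index(1), metis reflect_index)

lemma axis_reflection_comp: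
  assumes "axis_reflection m e" "axis_reflection m e'"
  shows "axis_reflection m (\<lambda>i. e (e' i))"
  using assms reflect_index[of _ m] unfolding axis_reflection_def by (elim disjE) simp_all

lemma axis_reflection_image:
  assumes "axis_reflection m e"
  shows "e ` {1..m} = {1..m}"
  using axis_reflection_mem[OF assms] axis_reflection_involution[OF assms]
  by (metis (no_types, lifting) image_eqI image_subsetI subsetI subset_antisym)

text \<open>Closed form of the eight symmetries: independent reflections of the coordinates, with or
  without exchanging them. Only values on the grid are prescribed, so extensional and plain
  functions are both covered.\<close>

definition square_symmetry :: "nat \<Rightarrow> (nat \<times> nat \<Rightarrow> nat \<times> nat) \<Rightarrow> bool" where
  "square_symmetry m \<sigma> \<longleftrightarrow> (\<exists>e e'. axis_reflection m e \<and> axis_reflection m e' \<and>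
     ((\<forall>i\<in>{1..m}. \<forall>j\<in>{1..m}. \<sigma> (i, j) = (e i, e' j)) \<or>
      (\<forall>i\<in>{1..m}. \<forall>j\<in>{1..m}. \<sigma> (i, j) = (e j, e' i))))"

lemma square_symmetryE:
  assumes "square_symmetry m \<sigma>"
  obtains (straight) e e' where "axis_reflection m e" "axis_reflection m e'"
      "\<And>i j. i \<in> {1..m} \<Longrightarrow> j \<in> {1..m} \<Longrightarrow> \<sigma> (i, j) = (e i, e' j)"
  | (swap) e e' where "axis_reflection m e" "axis_reflection m e'"
      "\<And>i j. i \<in> {1..m} \<Longrightarrow> j \<in> {1..m} \<Longrightarrow> \<sigma> (i, j) = (e j, e' i)"
  using assms unfolding square_symmetry_def by metis

lemma square_symmetry_straightI:
  assumes "axis_reflection m e" "axis_reflection m e'"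
    "\<And>i j. i \<in> {1..m} \<Longrightarrow> j \<in> {1..m} \<Longrightarrow> \<sigma> (i, j) = (e i, e' j)"
  shows "square_symmetry m \<sigma>"
  using assms unfolding square_symmetry_def by blast

lemma square_symmetry_swapI:
  assumes "axis_reflection m e" "axis_reflection m e'"
    "\<And>i j. i \<in> {1..m} \<Longrightarrow> j \<in> {1..m} \<Longrightarrow> \<sigma> (i, j) = (e j, e' i)"
  shows "square_symmetry m \<sigma>"
  using assms unfolding square_symmetry_def by blast

lemma square_symmetry_mem:
  assumes "square_symmetry m \<sigma>" "v \<in> pverts m m"
  shows "\<sigma> v \<in> pverts m m"
  using assms(1)
proof (cases rule: square_symmetryE)
  case (straight e e')
  then show ?thesis using assms(2) axis_reflection_mem[of m] unfolding pverts_def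
    by (metis (no_types, lifting) mem_Sigma_iff surj_pair)
next
  case (swap e e')
  then show ?thesis using assms(2) axis_reflection_mem[of m] unfolding pverts_def
    by (metis (no_types, lifting) mem_Sigma_iff surj_pair)
qed

lemma square_symmetry_comp:
  assumes "square_symmetry m \<sigma>" "square_symmetry m \<tau>"
  shows "square_symmetry m (compose (pverts m m) \<sigma> \<tau>)"
proof -
  have comp: "compose (pverts m m) \<sigma> \<tau> (i, j) = \<sigma> (\<tau> (i, j))" if "i \<in> {1..m}" "j \<in> {1..m}" for i j
    using that by (simp add: compose_def pverts_def)
  show ?thesis
    using assms(2)
  proof (cases rule: square_symmetryE)
    case t: (straight u u')
    show ?thesis
      using assms(1)
    proof (cases rule: square_symmetryE)
      case s: (straight e e')
      show ?thesis
        by (rule square_symmetry_straightI[OF axis_reflection_comp[OF s(1) t(1)] axis_reflection_comp[OF s(2) t(2)]])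
          (simp only: comp t(3) s(3)[OF axis_reflection_mem[OF t(1)] axis_reflection_mem[OF t(2)]])
    next
      case s: (swap e e')
      show ?thesis
        by (rule square_symmetry_swapI[OF axis_reflection_comp[OF s(1) t(2)] axis_reflection_comp[OF s(2) t(1)]])
          (simp only: comp t(3) s(3)[OF axis_reflection_mem[OF t(1)] axis_reflection_mem[OF t(2)]])
    qed
  next
    case t: (swap u u')
    show ?thesis
      using assms(1)
    proof (cases rule: square_symmetryE)
      case s: (straight e e')
      show ?thesis
        by (rule square_symmetry_swapI[OF axis_reflection_comp[OF s(1) t(1)] axis_reflection_comp[OF s(2) t(2)]])
          (simp only: comp t(3) s(3)[OF axis_reflection_mem[OF t(1)] axis_reflection_mem[OF t(2)]])
    next
      case s: (swap e e')
      show ?thesis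
        by (rule square_symmetry_straightI[OF axis_reflection_comp[OF s(1) t(2)] axis_reflection_comp[OF s(2) t(1)]])
          (simp only: comp t(3) s(3)[OF axis_reflection_mem[OF t(1)] axis_reflection_mem[OF t(2)]])
    qed
  qed
qed

lemma square_symmetry_inverse:
  assumes "square_symmetry m \<sigma>"
  obtains \<tau> where "square_symmetry m \<tau>" "\<And>v. v \<in> pverts m m \<Longrightarrow> \<sigma> (\<tau> v) = v \<and> \<tau> (\<sigma> v) = v"
  using assms
proof (cases rule: square_symmetryE)
  case (straight e e')
  show ?thesis
  proof (rule that[of "\<lambda>(i, j). (e i, e' j)"])
    show "square_symmetry m (\<lambda>(i, j). (e i, e' j))"
      by (rule square_symmetry_straightI[OF straight(1,2)]) simp
    show "\<sigma> (case v of (i, j) \<Rightarrow> (e i, e' j)) = v \<and> (case \<sigma> v of (i, j) \<Rightarrow> (e i, e' j)) = v"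
      if "v \<in> pverts m m" for v
      using that straight(3) axis_reflection_mem[OF straight(1)] axis_reflection_mem[OF straight(2)]
        axis_reflection_involution[OF straight(1)] axis_reflection_involution[OF straight(2)]
      unfolding pverts_def by (cases v) (simp del: atLeastAtMost_iff)
  qed
next
  case (swap e e')
  show ?thesis
  \<comment> \<open>Solving \<open>(e j, e' i) = (k, l)\<close> gives \<open>i = e' l\<close> and
    \<open>j = e k\<close>, since both maps are involutions.\<close>
  proof (rule that[of "\<lambda>(i, j). (e' j, e i)"])
    show "square_symmetry m (\<lambda>(i, j). (e' j, e i))"
      by (rule square_symmetry_swapI[OF swap(2,1)]) simp
    show "\<sigma> (case v of (i, j) \<Rightarrow> (e' j, e i)) = v \<and> (case \<sigma> v of (i, j) \<Rightarrow> (e' j, e i)) = v"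
      if "v \<in> pverts m m" for v
      using that swap(3) axis_reflection_mem[OF swap(1)] axis_reflection_mem[OF swap(2)]
        axis_reflection_involution[OF swap(1)] axis_reflection_involution[OF swap(2)]
      unfolding pverts_def by (cases v) (simp del: atLeastAtMost_iff)
  qed
qed

lemma square_symmetry_Bij:
  assumes "square_symmetry m \<sigma>" "\<sigma> \<in> extensional (pverts m m)"
  shows "\<sigma> \<in> Bij (pverts m m)"
proof -
  obtain \<tau> where \<tau>: "square_symmetry m \<tau>" "\<And>v. v \<in> pverts m m \<Longrightarrow> \<sigma> (\<tau> v) = v \<and> \<tau> (\<sigma> v) = v"
    using square_symmetry_inverse[OF assms(1)] by blast
  have "bij_betw \<sigma> (pverts m m) (pverts m m)"
    by (rule bij_betw_byWitness[where f' = \<tau>])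
      (use \<tau> square_symmetry_mem[OF assms(1)] square_symmetry_mem[OF \<tau>(1)] in auto)
  then show ?thesis using assms(2) by (simp add: Bij_def)
qed

lemma square_symmetry_m_inv:
  assumes "square_symmetry m \<sigma>" "\<sigma> \<in> Bij (pverts m m)"
  shows "square_symmetry m (inv\<^bsub>BijGroup (pverts m m)\<^esub> \<sigma>)"
proof -
  obtain \<tau> where \<tau>: "square_symmetry m \<tau>" "\<And>v. v \<in> pverts m m \<Longrightarrow> \<sigma> (\<tau> v) = v \<and> \<tau> (\<sigma> v) = v"
    using square_symmetry_inverse[OF assms(1)] by blast
  have "(inv\<^bsub>BijGroup (pverts m m)\<^esub> \<sigma>) v = \<tau> v" if "v \<in> pverts m m" for v
  proof -
    have "inv_into (pverts m m) \<sigma> v = \<tau> v"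
      using assms(2) \<tau>(2)[OF that] square_symmetry_mem[OF \<tau>(1) that]
      by (intro inv_into_f_eq) (auto simp: Bij_def bij_betw_def)
    then show ?thesis using that by (simp add: inv_BijGroup[OF assms(2)])
  qed
  then have eq: "(inv\<^bsub>BijGroup (pverts m m)\<^esub> \<sigma>) (i, j) = \<tau> (i, j)" if "i \<in> {1..m}" "j \<in> {1..m}" for i j
    using that by (simp add: pverts_def)
  show ?thesis using \<tau>(1) unfolding square_symmetry_def by (simp only: eq cong: ball_cong)
qed

lemma psymmetries_square_symmetry:
  assumes "\<sigma> \<in> psymmetries m"
  shows "square_symmetry m \<sigma>"
proof -
  let ?V = "pverts m m"
  let ?rot = "\<lambda>(i, j)\<in>?V. (m + 1 - j, i)" and ?ref = "\<lambda>(i, j)\<in>?V. (i, m + 1 - j)"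
  have ax: "axis_reflection m (\<lambda>i. i)" "axis_reflection m (\<lambda>i. m + 1 - i)"
    by (simp_all add: axis_reflection_def)
  have "square_symmetry m ?rot"
    by (rule square_symmetry_swapI[OF ax(2,1)]) (simp add: pverts_def)
  moreover have "square_symmetry m ?ref"
    by (rule square_symmetry_straightI[OF ax]) (simp add: pverts_def)
  ultimately have gen: "square_symmetry m h \<and> h \<in> Bij ?V" if "h \<in> {?rot, ?ref}" for h
    using that square_symmetry_Bij by auto
  have "\<sigma> \<in> generate (BijGroup ?V) {?rot, ?ref}" using assms by (simp add: psymmetries_def)
  \<comment> \<open>Membership in \<open>Bij\<close> is carried through the induction because it
    identifies the group inverse with the inverse map.\<close>
  then have "square_symmetry m \<sigma> \<and> \<sigma> \<in> Bij ?V"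
  proof induction
    case one
    have "square_symmetry m (\<one>\<^bsub>BijGroup ?V\<^esub>)"
      by (rule square_symmetry_straightI[OF ax(1,1)]) (simp add: BijGroup_def pverts_def)
    then show ?case using group.is_monoid[OF group_BijGroup, THEN monoid.one_closed]
      by (metis BijGroup_def partial_object.select_convs(1))
  next
    case (incl h)
    then show ?case using gen by blast
  next
    case (inv h)
    then have "square_symmetry m h" "h \<in> Bij ?V" using gen by blast+
    moreover from this have "inv\<^bsub>BijGroup ?V\<^esub> h \<in> Bij ?V"
      by (simp add: inv_BijGroup restrict_inv_into_Bij)
    ultimately show ?case using square_symmetry_m_inv by blast
  next
    case (eng h1 h2)
    then show ?case using square_symmetry_comp[of m h1 h2] compose_Bij[of h1 ?V h2]
      by (simp add: BijGroup_def)
  qed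
  then show ?thesis by blast
qed

subsection \<open>Counting labelings up to symmetry\<close>

text \<open>A splitting into two parts is unique up to moving a constant across; as the first parts
  are nonnegative and both attain 0, that constant is 0.\<close>

lemma separated_sum_unique:
  fixes A B A' B' :: "'a \<Rightarrow> nat"
  assumes eq: "\<And>i j. i \<in> I \<Longrightarrow> j \<in> I \<Longrightarrow> A i + B j = A' i + B' j"
    and "0 \<in> A ` I" "0 \<in> A' ` I" and "i \<in> I"
  shows "A i = A' i" "B i = B' i"
proof -
  obtain u u' where u: "u \<in> I" "A u = 0" "u' \<in> I" "A' u' = 0" using assms(2,3) by auto
  then show "B i = B' i" using eq[of u i] eq[of u' i] \<open>i \<in> I\<close> by simp
  then show "A i = A' i" using eq[of i i] \<open>i \<in> I\<close> by simp
qed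

text \<open>If \<open>e\<close> were the reversal, the images of 0 under the two permutations would
  add up to \<open>m - 1\<close>, yet both lie in the lower half.\<close>

lemma mirror_perms_eqI:
  assumes "\<pi> \<in> mirror_perms m" "\<pi>' \<in> mirror_perms m" "m \<ge> 3"
    and e: "axis_reflection m e"
    and eq: "\<And>i. i \<in> {1..m} \<Longrightarrow> \<pi>' (i - 1) = \<pi> (e i - 1)"
  shows "\<pi> = \<pi>'"
proof -
  have "\<not> (\<forall>i\<in>{1..m}. e i = m + 1 - i)"
  proof
    assume "\<forall>i\<in>{1..m}. e i = m + 1 - i"
    then have "e 1 = m" using assms(3) by simp
    then have "\<pi>' 0 = \<pi> (m - 1)" using eq[of 1] assms(3) by simp
    also have "\<dots> = m - 1 - \<pi> 0" using assms(1,3) by (auto simp: mirror_perms_def dest: spec[of _ 0])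
    finally have "\<pi>' 0 = m - 1 - \<pi> 0" .
    moreover have "\<pi> 0 < (m - 1) div 2" "\<pi>' 0 < (m - 1) div 2"
      using assms(1,2) unfolding mirror_perms_def by blast+
    ultimately show False by linarith
  qed
  then have id: "\<forall>i\<in>{1..m}. e i = i" using e unfolding axis_reflection_def by blast
  show ?thesis
  proof
    fix p
    show "\<pi> p = \<pi>' p"
    proof (cases "p < m")
      case True
      then show ?thesis using eq[of "Suc p"] id by simp
    next
      case False
      then show ?thesis
        using assms(1,2) permutes_not_in[of \<pi> "{..<m}" p] permutes_not_in[of \<pi>' "{..<m}" p]
        by (simp add: mirror_perms_def)
    qed
  qed
qed

lemma row_part_inject:
  assumes "p < row_prod xs" "p' < row_prod xs" "col_prod xs > 0" "row_part xs p = row_part xs p'"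
  shows "p = p'"
  using part_sum_inject[of p xs 0 p' 0] assms by simp

lemma col_part_inject:
  assumes "q < col_prod xs" "q' < col_prod xs" "row_prod xs > 0" "col_part xs q = col_part xs q'"
  shows "q = q'"
  using part_sum_inject[of 0 xs q 0 q'] assms by simp

lemma permutes_shift_image:
  fixes m :: nat
  assumes "\<pi> permutes {..<m}"
  shows "(\<lambda>i. f (\<pi> (i - 1))) ` {1..m} = f ` {..<m}"
proof -
  have "(\<lambda>i. i - 1) ` {1..m} = {..<m}"
  proof (intro equalityI subsetI)
    fix p assume "p \<in> {..<m}"
    then show "p \<in> (\<lambda>i. i - 1) ` {1..m}" by (intro image_eqI[of _ _ "p + 1"]) auto
  qed auto
  then have "(\<lambda>i. f (\<pi> (i - 1))) ` {1..m} = f ` \<pi> ` {..<m}" by (metis image_image)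
  then show ?thesis using permutes_image[OF assms] by simp
qed

definition seq_labeling ::
  "nat \<Rightarrow> (nat \<Rightarrow> nat) \<Rightarrow> nat list \<times> (nat \<Rightarrow> nat) \<times> (nat \<Rightarrow> nat) \<Rightarrow> nat \<times> nat \<Rightarrow> nat" where
  "seq_labeling m F = (\<lambda>(xs, \<pi>, \<rho>). grid_labeling m F (row_part xs \<circ> \<pi>) (col_part xs \<circ> \<rho>))"

text \<open>Injectivity of \<open>F\<close> strips off the folding, so the symmetry relates two grid
  sums. Without exchange of the axes the row and column parts agree separately up to reflection,
  hence the value sets coincide and yield the sequence, then the permutations. With exchange, 1
  would be a column value.\<close>

lemma seq_labeling_symmetry_inject:
  assumes "m \<ge> 3" and F: "inj_on F {..<m * m}"
    and xs: "xs \<in> projective_factorization_seqs m m" and ys: "ys \<in> projective_factorization_seqs m m"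
    and perms: "\<pi> \<in> mirror_perms m" "\<rho> \<in> mirror_perms m" "\<pi>' \<in> mirror_perms m" "\<rho>' \<in> mirror_perms m"
    and \<sigma>: "\<sigma> \<in> psymmetries m"
    and eq: "seq_labeling m F (ys, \<pi>', \<rho>') = compose (pverts m m) (seq_labeling m F (xs, \<pi>, \<rho>)) \<sigma>"
  shows "xs = ys \<and> \<pi> = \<pi>' \<and> \<rho> = \<rho>'"
proof -
  note xsD = projective_factorization_seqsD[OF xs] and ysD = projective_factorization_seqsD[OF ys]
  let ?I = "{1..m}"
  define A B A' B' where "A = (\<lambda>i. row_part xs (\<pi> (i - 1)))" and "B = (\<lambda>j. col_part xs (\<rho> (j - 1)))"
    and "A' = (\<lambda>i. row_part ys (\<pi>' (i - 1)))" and "B' = (\<lambda>j. col_part ys (\<rho>' (j - 1)))"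
  note defs = A_def B_def A'_def B'_def
  have lt: "\<mu> (i - 1) < m" if "\<mu> \<in> mirror_perms m" "i \<in> ?I" for \<mu> i
    using that permutes_in_image[of \<mu> "{..<m}" "i - 1"] by (auto simp: mirror_perms_def)
  have images: "A ` ?I = row_set xs" "B ` ?I = col_set xs" "A' ` ?I = row_set ys" "B' ` ?I = col_set ys"
    using perms xsD(3,4) ysD(3,4)
    by (simp_all only: permutes_shift_image defs row_set_def col_set_def mirror_perms_def mem_Collect_eq)
  have zeros: "0 \<in> A ` ?I" "0 \<in> B ` ?I" "0 \<in> A' ` ?I" "0 \<in> B' ` ?I"
    unfolding images using zero_in_sets xsD ysD by blast+
  have AB: "A i + B j < m * m" if "i \<in> ?I" "j \<in> ?I" for i j
    using part_sum_less[of "\<pi> (i - 1)" xs "\<rho> (j - 1)"] lt perms that xsD by (simp add: defs)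
  have AB': "A' i + B' j < m * m" if "i \<in> ?I" "j \<in> ?I" for i j
    using part_sum_less[of "\<pi>' (i - 1)" ys "\<rho>' (j - 1)"] lt perms that ysD by (simp add: defs)
  have F_eq: "A' i + B' j = A k + B l" if "i \<in> ?I" "j \<in> ?I" "k \<in> ?I" "l \<in> ?I" "\<sigma> (i, j) = (k, l)"
    for i j k l
  proof -
    have "seq_labeling m F (ys, \<pi>', \<rho>') (i, j) = seq_labeling m F (xs, \<pi>, \<rho>) (k, l)"
      using that eq by (simp add: compose_def pverts_def)
    then have "F (A' i + B' j) = F (A k + B l)"
      using that by (simp add: seq_labeling_def grid_labeling_apply defs del: atLeastAtMost_iff)
    then show ?thesis using inj_onD[OF F] AB AB' that by simp
  qed
  from psymmetries_square_symmetry[OF \<sigma>] show ?thesis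
  proof (cases rule: square_symmetryE)
    case (straight e e')
    note mem = axis_reflection_mem[OF straight(1)] axis_reflection_mem[OF straight(2)]
    note im = axis_reflection_image[OF straight(1)] axis_reflection_image[OF straight(2)]
    have sum: "A' i + B' j = A (e i) + B (e' j)" if "i \<in> ?I" "j \<in> ?I" for i j
      using F_eq[OF that mem(1)[OF that(1)] mem(2)[OF that(2)] straight(3)[OF that]] .
    have zero: "0 \<in> (\<lambda>i. A (e i)) ` ?I" using zeros(1) im(1) by (metis image_image)
    have AB_eq: "A' i = A (e i)" "B' i = B (e' i)" if "i \<in> ?I" for i
      using separated_sum_unique[where A = A' and B = B' and A' = "\<lambda>i. A (e i)" and B' = "\<lambda>j. B (e' j)",
        OF _ zeros(3) zero that] sum by blast+
    have "A' ` ?I = (\<lambda>i. A (e i)) ` ?I" "B' ` ?I = (\<lambda>i. B (e' i)) ` ?I"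
      using AB_eq by (auto intro!: image_cong simp del: atLeastAtMost_iff)
    then have "row_set xs = row_set ys" "col_set xs = col_set ys"
      using im images by (metis image_image)+
    then have xy: "xs = ys" using row_set_col_set_inject xsD(1) ysD(1) by blast
    have "\<pi>' (i - 1) = \<pi> (e i - 1)" if "i \<in> ?I" for i
    proof (rule row_part_inject)
      show "\<pi>' (i - 1) < row_prod xs" "\<pi> (e i - 1) < row_prod xs"
        using lt[OF perms(3) that] lt[OF perms(1) mem(1)[OF that]] unfolding xsD .
      show "col_prod xs > 0" using assms(1) xsD by simp
      show "row_part xs (\<pi>' (i - 1)) = row_part xs (\<pi> (e i - 1))"
        using AB_eq(1)[OF that] unfolding defs xy .
    qed
    then have "\<pi> = \<pi>'" using mirror_perms_eqI[OF perms(1,3) assms(1) straight(1)] by blast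
    moreover have "\<rho>' (i - 1) = \<rho> (e' i - 1)" if "i \<in> ?I" for i
    proof (rule col_part_inject)
      show "\<rho>' (i - 1) < col_prod xs" "\<rho> (e' i - 1) < col_prod xs"
        using lt[OF perms(4) that] lt[OF perms(2) mem(2)[OF that]] unfolding xsD .
      show "row_prod xs > 0" using assms(1) xsD by simp
      show "col_part xs (\<rho>' (i - 1)) = col_part xs (\<rho> (e' i - 1))"
        using AB_eq(2)[OF that] unfolding defs xy .
    qed
    then have "\<rho> = \<rho>'" using mirror_perms_eqI[OF perms(2,4) assms(1) straight(2)] by blast
    ultimately show ?thesis using xy by blast
  next
    case (swap e e')
    note mem = axis_reflection_mem[OF swap(1)] axis_reflection_mem[OF swap(2)]
    note im = axis_reflection_image[OF swap(1)] axis_reflection_image[OF swap(2)]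
    have sum: "A' i + B' j = B (e' i) + A (e j)" if "i \<in> ?I" "j \<in> ?I" for i j
      using F_eq[OF that mem(1)[OF that(2)] mem(2)[OF that(1)] swap(3)[OF that]] by simp
    have zero: "0 \<in> (\<lambda>i. B (e' i)) ` ?I" using zeros(2) im(2) by (metis image_image)
    have AB_eq: "A' i = B (e' i)" if "i \<in> ?I" for i
      using separated_sum_unique(1)[where A = A' and B = B' and A' = "\<lambda>i. B (e' i)" and B' = "\<lambda>j. A (e j)",
        OF _ zeros(3) zero that] sum by blast
    have "A' ` ?I = (\<lambda>i. B (e' i)) ` ?I"
      using AB_eq by (auto intro!: image_cong simp del: atLeastAtMost_iff)
    then have "row_set ys = col_set xs" using im images by (metis image_image)
    then show ?thesis using one_in_row_set ysD one_notin_col_set xsD by metis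
  qed
qed

lemma seq_labeling_magic:
  fixes c c' e :: int
  assumes m: "odd m" "m \<ge> 3"
    and xs: "xs \<in> projective_factorization_seqs m m"
    and perms: "\<pi> \<in> mirror_perms m" "\<rho> \<in> mirror_perms m"
    and bij_F: "bij_betw F {..<m * m} {1..m * m}"
    and F: "\<And>d. d < m * m \<Longrightarrow> 2 * int (F d) = (if even d then c + e * int d else c' - e * int d)"
    and S: "int S = c + c'"
  shows "seq_labeling m F (xs, \<pi>, \<rho>) \<in> c4_face_magic_labelings m m S"
proof -
  note xsD = projective_factorization_seqsD[OF xs]
  let ?a = "row_part xs \<circ> \<pi>" and ?b = "col_part xs \<circ> \<rho>"
  have lt: "\<mu> p < m" if "\<mu> \<in> mirror_perms m" "p < m" for \<mu> p
    using that permutes_in_image[of \<mu> "{..<m}" p] by (auto simp: mirror_perms_def)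
  have parity: "even (\<mu> p) = even p" and refl: "\<mu> (m - 1 - p) = m - 1 - \<mu> p"
    if "\<mu> \<in> mirror_perms m" "p < m" for \<mu> p
    using that unfolding mirror_perms_def by blast+
  have inj_perm: "\<mu> p = \<mu> q \<longleftrightarrow> p = q" if "\<mu> \<in> mirror_perms m" for \<mu> p q
    using that permutes_inj[of \<mu> "{..<m}"] by (auto simp: mirror_perms_def inj_eq)
  let ?D = "{..<m} \<times> {..<m}" and ?g = "\<lambda>(p, q). ?a p + ?b q"
  have inj: "inj_on ?g ?D"
  proof (rule inj_onI, clarsimp)
    fix p q p' q'
    assume "p < m" "q < m" "p' < m" "q' < m"
      "row_part xs (\<pi> p) + col_part xs (\<rho> q) = row_part xs (\<pi> p') + col_part xs (\<rho> q')"
    then have "\<pi> p = \<pi> p' \<and> \<rho> q = \<rho> q'" using lt perms xsD by (intro part_sum_inject) simp_all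
    then show "p = p' \<and> q = q'" using inj_perm perms by simp
  qed
  have "?g ` ?D \<subseteq> {..<m * m}"
    using part_sum_less[of _ xs] lt perms xsD by auto
  moreover have "card (?g ` ?D) = card {..<m * m}" using card_image[OF inj] by simp
  ultimately have "?g ` ?D = {..<m * m}" by (intro card_subset_eq) auto
  then have bij: "bij_betw ?g ?D {..<m * m}" using inj by (simp add: bij_betw_def)
  have "even (?a p) = even p" "even (?b p) = even p"
    "?a p + ?a (m - 1 - p) = row_part xs (m - 1)" "?b p + ?b (m - 1 - p) = col_part xs (m - 1)"
    if "p < m" for p
    using even_parts[of xs "\<pi> p"] even_parts[of xs "\<rho> p"] part_reflect[of "\<pi> p" xs]
      part_reflect[of "\<rho> p" xs] lt[OF perms(1) that] lt[OF perms(2) that]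
      parity[OF perms(1) that] parity[OF perms(2) that]
      refl[OF perms(1) that] refl[OF perms(2) that] xsD m
    by auto
  then show ?thesis unfolding seq_labeling_def prod.case
    by (intro grid_labeling_magic[OF m _ _ _ _ bij bij_F F S]) auto
qed

section \<open>Passage to classes of labelings\<close>

lemma symmetry_rel_refl:
  assumes "f \<in> c4_face_magic_labelings m m S"
  shows "(f, f) \<in> symmetry_rel m S"
proof -
  have "\<one>\<^bsub>BijGroup (pverts m m)\<^esub> \<in> psymmetries m"
    unfolding psymmetries_def by (rule generate.one)
  \<comment> \<open>Labelings are extensional, so composing with the restricted identity changes
    nothing.\<close>
  moreover have "f = compose (pverts m m) f (\<one>\<^bsub>BijGroup (pverts m m)\<^esub>)"
    using assms
    by (auto simp: c4_face_magic_labelings_def BijGroup_def compose_def extensional_def fun_eq_iff)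
  ultimately show ?thesis using assms by (auto simp: symmetry_rel_def)
qed

lemma finite_c4_face_magic_labelings: "finite (c4_face_magic_labelings m n S)"
proof (rule finite_subset)
  show "c4_face_magic_labelings m n S \<subseteq> (\<Pi>\<^sub>E v\<in>pverts m n. {1..m * n})"
    by (auto simp: c4_face_magic_labelings_def PiE_def dest: bij_betwE)
  show "finite (\<Pi>\<^sub>E v\<in>pverts m n. {1..m * n})"
    by (intro finite_PiE) (simp_all add: pverts_def)
qed

text \<open>Sending each triple of a sequence and two permutations to the class of its labeling is
  injective, which gives the product on the left.\<close>

lemma num_labelings_ge:
  fixes c c' e :: int
  assumes m: "odd m" "m \<ge> 3"
    and bij_F: "bij_betw F {..<m * m} {1..m * m}"
    and F: "\<And>d. d < m * m \<Longrightarrow> 2 * int (F d) = (if even d then c + e * int d else c' - e * int d)"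
    and S: "int S = c + c'"
  shows "tau m m * (card (mirror_perms m))\<^sup>2 \<le> num_labelings_up_to_symmetry m S"
proof -
  let ?P = "mirror_perms m" and ?R = "symmetry_rel m S" and ?L = "c4_face_magic_labelings m m S"
  let ?D = "projective_factorization_seqs m m \<times> ?P \<times> ?P"
  let ?cls = "\<lambda>x. ?R `` {seq_labeling m F x}"
  have mem: "seq_labeling m F x \<in> ?L" if "x \<in> ?D" for x
    using that by (auto intro!: seq_labeling_magic[OF m _ _ _ bij_F F S])
  have inj: "inj_on ?cls ?D"
  proof (rule inj_onI)
    fix x y
    assume x: "x \<in> ?D" and y: "y \<in> ?D" and eq: "?cls x = ?cls y"
    \<comment> \<open>By reflexivity the labeling of \<open>y\<close> lies in its own class, hence
      in that of \<open>x\<close>.\<close>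
    have "(seq_labeling m F x, seq_labeling m F y) \<in> ?R"
      using symmetry_rel_refl[OF mem[OF y]] eq by blast
    then obtain \<sigma> where \<sigma>: "\<sigma> \<in> psymmetries m"
      "seq_labeling m F y = compose (pverts m m) (seq_labeling m F x) \<sigma>"
      by (auto simp: symmetry_rel_def)
    obtain xs \<pi> \<rho> ys \<pi>' \<rho>' where "x = (xs, \<pi>, \<rho>)" "y = (ys, \<pi>', \<rho>')" by (metis prod_cases3)
    then show "x = y"
      using seq_labeling_symmetry_inject[OF m(2) bij_betw_imp_inj_on[OF bij_F] _ _ _ _ _ _ \<sigma>(1),
        of xs ys \<pi> \<rho> \<pi>' \<rho>'] \<sigma>(2) x y by simp
  qed
  have "?cls ` ?D \<subseteq> ?L // ?R" using mem by (auto intro: quotientI)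
  moreover have "finite (?L // ?R)"
    using finite_c4_face_magic_labelings by (simp add: quotient_def)
  ultimately have "card ?D \<le> card (?L // ?R)" using card_inj_on_le[OF inj] by blast
  then show ?thesis
    by (simp add: card_cartesian_product tau_def num_labelings_up_to_symmetry_def power2_eq_square)
qed

section \<open>Folding maps for the two face sums\<close>

definition high_fold :: "nat \<Rightarrow> nat \<Rightarrow> nat" where
  "high_fold N d = (if even d then (N + 1 + d) div 2 else (N - d) div 2)"

text \<open>The factor \<open>1\<close> before \<open>int d\<close> matches the general label
  formula with \<open>c = N + 1\<close>, \<open>c' = N\<close> and \<open>e = 1\<close>, so that
  \<open>c + c' = 2 * N + 1\<close>. For odd \<open>N\<close> the halvings are exact.\<close>

lemma double_high_fold:
  assumes "odd N" "d < N"
  shows "2 * int (high_fold N d) = (if even d then int N + 1 + 1 * int d else int N - 1 * int d)"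
proof (cases "even d")
  case True
  have "2 dvd N + 1 + d" using True assms(1) by simp
  then have "2 * high_fold N d = N + 1 + d"
    using True unfolding high_fold_def by (simp only: if_True dvd_mult_div_cancel)
  then have "2 * int (high_fold N d) = int (N + 1 + d)" by linarith
  then show ?thesis using True by simp
next
  case False
  have "2 dvd N - d" using False assms(1) by simp
  then have "2 * high_fold N d = N - d"
    using False unfolding high_fold_def by (simp only: if_False dvd_mult_div_cancel)
  then have "2 * int (high_fold N d) = int (N - d)" by linarith
  then show ?thesis using False assms(2) by simp
qed

text \<open>Doubled values exceed \<open>N\<close> for even \<open>d\<close> and stay below
  \<open>N\<close> for odd \<open>d\<close>, so the two branches cannot collide.\<close>

lemma bij_betw_high_fold:
  assumes "odd N"
  shows "bij_betw (high_fold N) {..<N} {1..N}"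
proof -
  have inj: "inj_on (high_fold N) {..<N}"
  proof (rule inj_onI)
    fix d d' assume "d \<in> {..<N}" "d' \<in> {..<N}" "high_fold N d = high_fold N d'"
    then have "(if even d then int N + 1 + 1 * int d else int N - 1 * int d) =
        (if even d' then int N + 1 + 1 * int d' else int N - 1 * int d')"
      using double_high_fold[OF assms, of d] double_high_fold[OF assms, of d'] by (metis lessThan_iff)
    then show "d = d'" by (cases "even d"; cases "even d'") simp_all
  qed
  moreover have "high_fold N d \<in> {1..N}" if "d < N" for d
  proof -
    have "1 \<le> 2 * int (high_fold N d)" "2 * int (high_fold N d) \<le> 2 * int N"
      unfolding double_high_fold[OF assms that] using that by (cases "even d"; simp)+
    then show ?thesis by simp
  qed
  then have "high_fold N ` {..<N} \<subseteq> {1..N}" by blast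
  then have "high_fold N ` {..<N} = {1..N}"
    using card_image[OF inj] by (intro card_subset_eq) auto
  ultimately show ?thesis by (simp add: bij_betw_def)
qed

text \<open>With \<open>m = 2 * h + 1\<close>, the two cases of \<open>beta\<close> are the parities
  of \<open>h\<close>, and both give the product of factorials counting permutations within parity
  classes. Squaring accounts for rows and columns and turns the exponent \<open>h - 1\<close> into
  \<open>m - 3\<close>.\<close>

lemma card_mirror_perms_ge_beta:
  assumes "m \<ge> 3" "odd m"
  shows "2 ^ (m - 3) * (beta m)\<^sup>2 \<le> (card (mirror_perms m))\<^sup>2"
proof -
  from assms(2) obtain h where h: "m = 2 * h + 1" by (rule oddE)
  have h1: "h \<ge> 1" using assms h by simp
  have "beta m = fact ((h + 1) div 2) * fact (h div 2)"
  proof (cases "even h")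
    case True
    then obtain k where "h = 2 * k" by (rule evenE)
    moreover from this have "m = 4 * k + 1" using h by simp
    ultimately show ?thesis by (simp add: beta_def power2_eq_square)
  next
    case False
    then obtain k where k: "h = 2 * k + 1" by (rule oddE)
    then have m: "m = 4 * k + 3" using h by simp
    then have "m mod 4 \<noteq> 1" "(m - 3) div 4 = k" "(m + 1) div 4 = k + 1" by presburger+
    moreover have "(h + 1) div 2 = k + 1" "h div 2 = k" using k by auto
    ultimately show ?thesis by (simp add: beta_def)
  qed
  then have "(beta m * 2 ^ (h - 1))\<^sup>2 \<le> (card (mirror_perms m))\<^sup>2"
    using card_mirror_perms[OF h1] h by (intro power_mono) simp_all
  moreover have "(2 ^ (h - 1))\<^sup>2 = (2 :: nat) ^ (m - 3)"
    using h h1 by (simp add: power_mult[symmetric] algebra_simps)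
  ultimately show ?thesis by (simp add: power_mult_distrib mult.commute)
qed

theorem theorem43:
  fixes m :: nat
  assumes "m \<ge> 3" and "odd m"
  shows "num_labelings_up_to_symmetry m (2 * m\<^sup>2 + 1) \<ge> tau m m * 2 ^ (m - 3) * (beta m)\<^sup>2
       \<and> num_labelings_up_to_symmetry m (2 * m\<^sup>2 + 3) \<ge> tau m m * 2 ^ (m - 3) * (beta m)\<^sup>2"
proof -
  let ?N = "m * m"
  have N: "odd ?N" using assms by simp
  \<comment> \<open>Complementary labels turn the face sum \<open>2 * ?N + 1\<close> into
    \<open>4 * (?N + 1) - (2 * ?N + 1) = 2 * ?N + 3\<close>; in the general formula
    \<open>c = ?N + 1\<close>, \<open>c' = ?N + 2\<close> and \<open>e = - 1\<close>.\<close>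
  let ?low = "\<lambda>d. ?N + 1 - high_fold ?N d"
  have count: "tau m m * 2 ^ (m - 3) * (beta m)\<^sup>2 \<le> tau m m * (card (mirror_perms m))\<^sup>2"
    using card_mirror_perms_ge_beta[OF assms] by (simp add: mult.assoc)
  have high: "tau m m * (card (mirror_perms m))\<^sup>2 \<le> num_labelings_up_to_symmetry m (2 * m\<^sup>2 + 1)"
    by (rule num_labelings_ge[OF assms(2,1) bij_betw_high_fold[OF N] double_high_fold[OF N]])
      (simp_all add: power2_eq_square)
  have flip: "bij_betw (\<lambda>k. ?N + 1 - k) {1..?N} {1..?N}"
    by (rule bij_betw_byWitness[where f' = "\<lambda>k. ?N + 1 - k"]) auto
  have bij_low: "bij_betw ?low {..<?N} {1..?N}"
    using bij_betw_trans[OF bij_betw_high_fold[OF N] flip] by (simp add: comp_def)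
  have low: "2 * int (?low d) =
      (if even d then int ?N + 1 + (- 1) * int d else int ?N + 2 - (- 1) * int d)" if "d < ?N" for d
  proof -
    have "high_fold ?N d \<in> {1..?N}" using bij_betwE[OF bij_betw_high_fold[OF N]] that by blast
    then have "2 * int (?low d) = 2 * int ?N + 2 - 2 * int (high_fold ?N d)"
      by (simp add: of_nat_diff)
    then show ?thesis using double_high_fold[OF N that] by simp
  qed
  have "tau m m * (card (mirror_perms m))\<^sup>2 \<le> num_labelings_up_to_symmetry m (2 * m\<^sup>2 + 3)"
    by (rule num_labelings_ge[OF assms(2,1) bij_low low]) (simp_all add: power2_eq_square)
  with count high show ?thesis by (meson le_trans)
qed

end
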